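(* Let $G$ be a simple graph with $n$ vertices and minimum degree $\delta$ that satisfies $\delta(G)\geq 5$ or $\lambda(G)\geq 4$ or $\kappa(G)\geq 3$. Let $T$ be a pendant tree of $G$. Then $T$ has at most $\frac{12}{\delta+12}\,n$ blocks.
   Context: $\lambda(G)$ is the edge-connectivity (minimum number of edges whose removal disconnects $G$) and $\kappa(G)$ the vertex-connectivity. For $X\subseteq V$, $d_G(X)$ is the number of edges with exactly one endpoint in $X$; $d_G(v)$ is the degree. For vertices $v\neq w$, $\lambda_G(v,w)$ is the minimum of $d_G(X)$ over $X$ containing exactly one of $v,w$. A pair $\{v,w\}$ of distinct vertices is pendant if $\lambda_G(v,w)=\min\{d_G(v),d_G(w)\}$. For a tree $T$ whose vertex set (blocks) is a partition of $V$ and an edge $AB$ of $T$, $C_{AB}$ is the union of blocks in the component of $T-AB$ containing $A$, and $c(AB):=d_G(C_{AB})$. A pendant tree of $G$ is such a tree with: (i) every two distinct vertices in a common block form a pendant pair; (ii) for every edge $AB$ of $T$ there are $a\in A$, $b\in B$ with $\{a,b\}$ non-pendant; (iii) for every edge $AB$ of $T$ there are $a^*\in A$, $b^*\in B$ with $c(AB)=\lambda_G(a^*,b^* )$. *)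

theory Defs
  imports Complex_Main "HOL-Library.Disjoint_Sets"
begin

text \<open>
  A finite simple graph is a vertex set together with a set of two-element vertex sets.
  The same notions serve for the graph \<open>G = (V, E)\<close> (vertices of type \<open>'a\<close>) and for
  a tree whose vertices are blocks of a partition of \<open>V\<close> (vertices of type \<open>'a set\<close>).
\<close>

definition simple_graph :: "'a set \<Rightarrow> 'a set set \<Rightarrow> bool" where
  "simple_graph V E \<longleftrightarrow>
     finite V \<and> V \<noteq> {} \<and> (\<forall>e\<in>E. \<exists>u\<in>V. \<exists>v\<in>V. u \<noteq> v \<and> e = {u, v})"

definition adj_rel :: "'a set set \<Rightarrow> ('a \<times> 'a) set" where
  "adj_rel E = {(u, v). {u, v} \<in> E}"

definition connected_graph :: "'a set \<Rightarrow> 'a set set \<Rightarrow> bool" where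
  "connected_graph V E \<longleftrightarrow> V \<noteq> {} \<and> (\<forall>u\<in>V. \<forall>v\<in>V. (u, v) \<in> (adj_rel E)\<^sup>*)"

definition is_cycle :: "'a set set \<Rightarrow> 'a list \<Rightarrow> bool" where
  "is_cycle E xs \<longleftrightarrow> 3 \<le> length xs \<and> distinct xs \<and>
     (\<forall>i<length xs. {xs ! i, xs ! (Suc i mod length xs)} \<in> E)"

definition tree_graph :: "'a set \<Rightarrow> 'a set set \<Rightarrow> bool" where
  "tree_graph V E \<longleftrightarrow> simple_graph V E \<and> connected_graph V E \<and> (\<nexists>xs. is_cycle E xs)"

definition degree :: "'a set set \<Rightarrow> 'a \<Rightarrow> nat" where
  "degree E v = card {e \<in> E. v \<in> e}"

definition min_degree :: "'a set \<Rightarrow> 'a set set \<Rightarrow> nat" where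
  "min_degree V E = Min (degree E ` V)"

definition cut_size :: "'a set set \<Rightarrow> 'a set \<Rightarrow> nat" where
  "cut_size E X = card {e \<in> E. \<exists>x y. e = {x, y} \<and> x \<in> X \<and> y \<notin> X}"

definition local_edge_connectivity :: "'a set \<Rightarrow> 'a set set \<Rightarrow> 'a \<Rightarrow> 'a \<Rightarrow> nat" where
  "local_edge_connectivity V E v w = Min (cut_size E ` {X. X \<subseteq> V \<and> (v \<in> X \<longleftrightarrow> w \<notin> X)})"

text \<open>Convention: a single-vertex graph, which no edge removal disconnects, gets the value 0.\<close>

definition edge_connectivity :: "'a set \<Rightarrow> 'a set set \<Rightarrow> nat" where
  "edge_connectivity V E =
     (if card V \<le> 1 then 0
      else Min (card ` {F. F \<subseteq> E \<and> \<not> connected_graph V (E - F)}))"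

text \<open>
  Convention: the least number of vertices whose removal leaves a disconnected graph or at
  most one vertex, so that the complete graph on \<open>n\<close> vertices has vertex-connectivity
  \<open>n - 1\<close>.
\<close>

definition vertex_connectivity :: "'a set \<Rightarrow> 'a set set \<Rightarrow> nat" where
  "vertex_connectivity V E =
     Min (card ` {S. S \<subseteq> V \<and>
       (\<not> connected_graph (V - S) {e \<in> E. e \<inter> S = {}} \<or> card (V - S) \<le> 1)})"

definition pendant_pair :: "'a set \<Rightarrow> 'a set set \<Rightarrow> 'a \<Rightarrow> 'a \<Rightarrow> bool" where
  "pendant_pair V E v w \<longleftrightarrow> v \<in> V \<and> w \<in> V \<and> v \<noteq> w \<and>
     local_edge_connectivity V E v w = min (degree E v) (degree E w)"

text \<open>
  For a tree with edge set \<open>TE\<close>, \<open>tree_side TE A B\<close> is the union of the blocks in the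
  component of \<open>A\<close> after deletion of the edge \<open>{A, B}\<close>.
\<close>

definition tree_side :: "'a set set set \<Rightarrow> 'a set \<Rightarrow> 'a set \<Rightarrow> 'a set" where
  "tree_side TE A B = \<Union> {D. (A, D) \<in> (adj_rel (TE - {{A, B}}))\<^sup>*}"

definition pendant_tree ::
  "'a set \<Rightarrow> 'a set set \<Rightarrow> 'a set set \<Rightarrow> 'a set set set \<Rightarrow> bool" where
  "pendant_tree V E P TE \<longleftrightarrow>
     partition_on V P \<and> tree_graph P TE \<and>
     (\<forall>A\<in>P. \<forall>v\<in>A. \<forall>w\<in>A. v \<noteq> w \<longrightarrow> pendant_pair V E v w) \<and>
     (\<forall>A B. {A, B} \<in> TE \<longrightarrow> (\<exists>a\<in>A. \<exists>b\<in>B. \<not> pendant_pair V E a b)) \<and>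
     (\<forall>A B. {A, B} \<in> TE \<longrightarrow>
        (\<exists>a\<in>A. \<exists>b\<in>B. cut_size E (tree_side TE A B) = local_edge_connectivity V E a b))"

end

theory Submission
  imports Defs
begin

text \<open>
  Every edge \<open>AB\<close> of a pendant tree gives a cut that is smaller than the degree of some vertex of
  \<open>A\<close> and of some vertex of \<open>B\<close>. In a simple graph a side of such a cut has more than \<open>\<delta>\<close> vertices,
  so leaves of the tree are large blocks. Two adjacent blocks of tree-degree 2 are both singletons
  or have at least \<open>\<delta> - 1\<close> vertices together, and three consecutive singletons of tree-degree 2 force
  \<open>\<delta> \<le> 4\<close>, \<open>\<lambda> \<le> 3\<close> and \<open>\<kappa> \<le> 2\<close>. Hence three consecutive blocks \<open>A\<close> of tree-degree 2 satisfy
  \<open>4 \<Sum>(|A| - 1) \<ge> \<delta>\<close>. Summing this over the tree, where the large leaves pay for the blocks close to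
  leaves and branchings, gives \<open>12 (n - |T|) \<ge> \<delta> |T|\<close>.
\<close>

section \<open>Edges between two vertex sets\<close>

text \<open>Edges with both ends in \<open>X \<inter> Y\<close> are counted twice.\<close>

definition edges_between :: "'a set set \<Rightarrow> 'a set \<Rightarrow> 'a set \<Rightarrow> nat" where
  "edges_between E X Y = (\<Sum>x\<in>X. \<Sum>y\<in>Y. of_bool ({x, y} \<in> E))"

lemma edges_between_commute: "edges_between E X Y = edges_between E Y X"
  unfolding edges_between_def by (subst sum.swap) (simp add: insert_commute)

lemma edges_between_Un_left:
  assumes "finite X" "finite Y" "X \<inter> Y = {}"
  shows "edges_between E (X \<union> Y) Z = edges_between E X Z + edges_between E Y Z"
  unfolding edges_between_def using assms by (simp add: sum.union_disjoint)

lemma edges_between_Un_right: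
  assumes "finite X" "finite Y" "X \<inter> Y = {}"
  shows "edges_between E Z (X \<union> Y) = edges_between E Z X + edges_between E Z Y"
  by (metis assms edges_between_Un_left edges_between_commute)

lemma edges_between_eq_sum: "edges_between E X Y = (\<Sum>x\<in>X. edges_between E {x} Y)"
  by (simp add: edges_between_def)

lemma edges_between_singleton:
  assumes "finite Y"
  shows "edges_between E {x} Y = card {y \<in> Y. {x, y} \<in> E}"
  using assms by (simp add: edges_between_def of_bool_def sum.If_cases Collect_conj_eq)

lemma edges_between_singletons_le: "edges_between E {x} {y} \<le> 1"
  by (cases "{x, y} \<in> E") (simp_all add: edges_between_def)

lemma no_edge_if_edges_between_0:
  assumes "edges_between E X Y = 0" "finite X" "finite Y" "x \<in> X" "y \<in> Y"
  shows "{x, y} \<notin> E"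
  using assms by (fastforce simp: edges_between_def)

section \<open>Cuts and degrees in simple graphs\<close>

context
  fixes V :: "'a set" and E :: "'a set set"
  assumes graph: "simple_graph V E"
begin

lemma finite_vertices: "finite V"
  using graph by (simp add: simple_graph_def)

lemma vertices_nonempty: "V \<noteq> {}"
  using graph by (simp add: simple_graph_def)

lemma edge_doubleton:
  assumes "e \<in> E"
  obtains u v where "u \<in> V" "v \<in> V" "u \<noteq> v" "e = {u, v}"
proof -
  have "\<forall>e\<in>E. \<exists>u\<in>V. \<exists>v\<in>V. u \<noteq> v \<and> e = {u, v}"
    using graph unfolding simple_graph_def by (elim conjE)
  from bspec[OF this assms] that show ?thesis
    by (elim bexE conjE)
qed

lemma finite_edges: "finite E"
proof (rule finite_subset)
  show "E \<subseteq> Pow V"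
    by (metis PowI edge_doubleton empty_subsetI insert_subset subsetI)
qed (simp add: finite_vertices)

lemma edge_ends:
  assumes "{x, y} \<in> E"
  shows "x \<in> V" "y \<in> V" "x \<noteq> y"
  using edge_doubleton[OF assms] by (metis doubleton_eq_iff)+

lemma edge_obtain:
  assumes "e \<in> E" "v \<in> e"
  obtains w where "e = {v, w}" "w \<in> V" "w \<noteq> v"
proof -
  obtain x y where xy: "x \<in> V" "y \<in> V" "x \<noteq> y" "e = {x, y}"
    using edge_doubleton assms by metis
  then consider "v = x" | "v = y"
    using assms by auto
  then show ?thesis
  proof cases
    case 1
    then show ?thesis
      using that[of y] xy by simp
  next
    case 2
    then show ?thesis
      using that[of x] xy by (simp add: insert_commute)
  qed
qed

lemma degree_eq_edges_between: "degree E v = edges_between E {v} V"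
proof -
  have "{e \<in> E. v \<in> e} = (\<lambda>w. {v, w}) ` {w \<in> V. {v, w} \<in> E}"
    (is "?F = _")
  proof
    show "?F \<subseteq> (\<lambda>w. {v, w}) ` {w \<in> V. {v, w} \<in> E}"
    proof
      fix e assume "e \<in> ?F"
      then obtain w where "e = {v, w}" "w \<in> V"
        using edge_obtain by (metis (lifting) mem_Collect_eq)
      with \<open>e \<in> ?F\<close> show "e \<in> (\<lambda>w. {v, w}) ` {w \<in> V. {v, w} \<in> E}"
        by simp
    qed
  qed auto
  moreover have "inj_on (\<lambda>w. {v, w}) {w \<in> V. {v, w} \<in> E}"
    by (auto simp: inj_on_def doubleton_eq_iff)
  ultimately show ?thesis
    by (simp add: degree_def edges_between_singleton finite_vertices card_image)
qed

text \<open>An edge leaving \<open>X\<close> has exactly one end in \<open>X\<close>, so ordered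
  pairs and edges correspond one to one and nothing is counted twice.\<close>

lemma cut_size_eq_edges_between:
  assumes "X \<subseteq> V"
  shows "cut_size E X = edges_between E X (V - X)"
proof -
  let ?S = "SIGMA x:X. {y \<in> V - X. {x, y} \<in> E}"
  have fin: "finite X" "finite (V - X)"
    using assms finite_vertices by (auto intro: finite_subset)
  have "{e \<in> E. \<exists>x y. e = {x, y} \<and> x \<in> X \<and> y \<notin> X} = (\<lambda>(x, y). {x, y}) ` ?S"
    (is "?F = _")
  proof
    show "?F \<subseteq> (\<lambda>(x, y). {x, y}) ` ?S"
    proof clarify
      fix x y assume "{x, y} \<in> E" "x \<in> X" "y \<notin> X"
      then show "{x, y} \<in> (\<lambda>(x, y). {x, y}) ` ?S"
        using edge_ends(2)[of x y] by (intro image_eqI[of _ _ "(x, y)"]) auto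
    qed
  qed auto
  moreover have "inj_on (\<lambda>(x, y). {x, y}) ?S"
    by (auto simp: inj_on_def doubleton_eq_iff)
  ultimately have "cut_size E X = card ?S"
    by (simp add: cut_size_def card_image)
  also have "\<dots> = edges_between E X (V - X)"
    using fin by (subst edges_between_eq_sum) (simp add: edges_between_singleton)
  finally show ?thesis .
qed

lemma cut_size_singleton: "cut_size E {v} = degree E v"
proof -
  have "{e \<in> E. \<exists>x y. e = {x, y} \<and> x \<in> {v} \<and> y \<notin> {v}} = {e \<in> E. v \<in> e}"
  proof (intro Collect_cong iffI conjI; elim conjE)
    fix e assume "e \<in> E" "v \<in> e"
    then obtain w where "e = {v, w}" "w \<noteq> v"
      by (rule edge_obtain)
    then show "\<exists>x y. e = {x, y} \<and> x \<in> {v} \<and> y \<notin> {v}"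
      by blast
  qed auto
  then show ?thesis
    by (simp add: cut_size_def degree_def)
qed

text \<open>The absence of loops gives the \<open>- 1\<close>, on which the size estimates below
  depend.\<close>

lemma edges_between_singleton_le:
  assumes "x \<in> M" "M \<subseteq> V"
  shows "edges_between E {x} M \<le> card M - 1"
proof -
  have fin: "finite M"
    using assms finite_vertices by (auto intro: finite_subset)
  have "card {y \<in> M. {x, y} \<in> E} \<le> card (M - {x})"
    using fin by (intro card_mono) (auto dest: edge_ends)
  with fin assms show ?thesis
    by (simp add: edges_between_singleton)
qed

section \<open>Minimum degree and the sizes of sides of small cuts\<close>

lemma min_degree_le:
  assumes "v \<in> V"
  shows "min_degree V E \<le> degree E v"
  using assms finite_vertices by (simp add: min_degree_def)

text \<open>Settles the case of a pendant tree with a single block.\<close>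

lemma min_degree_less_card: "min_degree V E + 1 \<le> card V"
proof -
  obtain v where v: "v \<in> V"
    using vertices_nonempty by blast
  have "degree E v \<le> card V - 1"
    using edges_between_singleton_le[OF v] degree_eq_edges_between by simp
  moreover have "card V > 0"
    using v finite_vertices card_gt_0_iff by blast
  ultimately show ?thesis
    using min_degree_le[OF v] by linarith
qed

text \<open>If \<open>card X\<close> were at most \<open>min_degree V E\<close>, every vertex of
  \<open>X\<close> would send an edge out of \<open>X\<close>. Such edges at the
  \<open>card X - 1\<close> vertices other than \<open>a\<close> make up for the neighbours of
  \<open>a\<close> inside \<open>X\<close>, so the cut would be at least
  \<open>degree E a\<close>.\<close>

lemma card_gt_min_degree_if_small_cut:
  assumes X: "X \<subseteq> V" and a: "a \<in> X" and less: "cut_size E X < degree E a"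
  shows "min_degree V E + 1 \<le> card X"
proof (rule ccontr)
  assume "\<not> ?thesis"
  then have small: "card X \<le> min_degree V E" by simp
  have fin: "finite X" "finite (V - X)"
    using X finite_vertices by (auto intro: finite_subset)
  have split: "degree E x = edges_between E {x} X + edges_between E {x} (V - X)" for x
    using edges_between_Un_right[OF fin, of E "{x}"] X
    by (simp add: degree_eq_edges_between Un_absorb1)
  have le: "edges_between E {x} X \<le> card X - 1" if "x \<in> X" for x
    using edges_between_singleton_le[OF that X] .
  have pos: "card X > 0"
    using a fin card_gt_0_iff by blast
  have "1 \<le> edges_between E {x} (V - X)" if "x \<in> X" for x
    using split[of x] le[OF that] min_degree_le[of x] that X small pos by fastforce
  then have "(\<Sum>x\<in>X - {a}. 1) \<le> (\<Sum>x\<in>X - {a}. edges_between E {x} (V - X))"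
    by (intro sum_mono) auto
  moreover have "cut_size E X =
      edges_between E {a} (V - X) + (\<Sum>x\<in>X - {a}. edges_between E {x} (V - X))"
    using fin a X by (simp add: cut_size_eq_edges_between sum.remove
        edges_between_eq_sum[of E X])
  ultimately show False
    using less split[of a] le[OF a] fin a by simp
qed

text \<open>The two cut inequalities are added; the edges from \<open>a\<close> to \<open>R\<close> and
  from \<open>b\<close> to \<open>L\<close> cancel.\<close>

lemma two_small_cuts:
  assumes L: "L \<subseteq> V" and R: "R \<subseteq> V" and disj: "L \<inter> R = {}"
    and a: "a \<in> V - L - R" and b: "b \<in> V - L - R" and ab: "a \<noteq> b"
    and La: "cut_size E L < degree E a" and Rb: "cut_size E R < degree E b"
    and s: "card (V - L - R) = s + 2"
  shows "s * min_degree V E + 2 * edges_between E L R \<le> s * (s + 3)"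
proof -
  define M where "M = V - L - R"
  define N where "N = M - {a, b}"
  let ?e = "edges_between E"
  have fin: "finite L" "finite R" "finite M" "finite N"
    using L R finite_vertices by (auto simp: M_def N_def intro: finite_subset)
  have M: "M \<subseteq> V" "a \<in> M" "b \<in> M" "card M = s + 2"
    using a b s by (auto simp: M_def)
  have N: "card N = s" "N \<subseteq> M"
    using M ab fin by (auto simp: N_def card_Diff_subset)
  have V_eq: "V = L \<union> (M \<union> R)" and VL: "V - L = M \<union> R" and VR: "V - R = M \<union> L"
    using L R disj by (auto simp: M_def)
  have M_eq: "M = {a} \<union> ({b} \<union> N)"
    using M by (auto simp: N_def)
  have disjM: "L \<inter> M = {}" "M \<inter> R = {}" "L \<inter> (M \<union> R) = {}" "M \<inter> L = {}"
    using disj by (auto simp: M_def)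
  have eV: "?e X V = ?e X L + ?e X M + ?e X R" for X
    using fin disjM by (subst V_eq) (simp add: edges_between_Un_right)
  have eM: "?e X M = ?e X {a} + ?e X {b} + ?e X N" for X
  proof -
    have "{a} \<inter> ({b} \<union> N) = {}" "{b} \<inter> N = {}"
      using ab by (auto simp: N_def)
    then show ?thesis
      using fin by (subst M_eq) (simp only: edges_between_Un_right finite.intros finite_UnI)
  qed
  have cL: "cut_size E L = ?e L {a} + ?e L {b} + ?e L N + ?e L R"
    using fin disjM L by (simp add: cut_size_eq_edges_between VL edges_between_Un_right eM)
  have cR: "cut_size E R = ?e R {a} + ?e R {b} + ?e R N + ?e R L"
    using fin disjM R by (simp add: cut_size_eq_edges_between VR edges_between_Un_right eM)
  have "?e {a} M \<le> s + 1" "?e {b} M \<le> s + 1"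
    using edges_between_singleton_le[of a M] edges_between_singleton_le[of b M] M by auto
  \<comment> \<open>Each strict inequality gains 1, which cancels the surplus in
    \<open>2 * (s + 1)\<close>.\<close>
  then have cuts: "?e L N + ?e R N + 2 * ?e L R \<le> 2 * s"
    using La Rb eV[of "{a}"] eV[of "{b}"] cL cR
      edges_between_commute[of E "{a}" L] edges_between_commute[of E "{a}" R]
      edges_between_commute[of E "{b}" L] edges_between_commute[of E "{b}" R]
      edges_between_commute[of E R L]
    by (simp add: degree_eq_edges_between)
  \<comment> \<open>The degree that a vertex of \<open>N\<close> cannot get within \<open>M\<close>
    must come from \<open>L\<close> and \<open>R\<close>, where \<open>cuts\<close> limits the
    total.\<close>
  have "min_degree V E \<le> ?e {x} L + ?e {x} R + (s + 1)" if "x \<in> N" for x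
    using min_degree_le[of x] edges_between_singleton_le[of x M] eV[of "{x}"] that N M
    by (simp add: degree_eq_edges_between subset_iff)
  then have "(\<Sum>x\<in>N. min_degree V E) \<le> (\<Sum>x\<in>N. ?e {x} L + ?e {x} R + (s + 1))"
    by (rule sum_mono)
  also have "\<dots> = ?e N L + ?e N R + (\<Sum>x\<in>N. s + 1)"
    by (simp only: sum.distrib edges_between_eq_sum[symmetric])
  finally have "s * min_degree V E \<le> ?e N L + ?e N R + s * (s + 1)"
    by (simp only: sum_constant N of_nat_id)
  with cuts show ?thesis
    using edges_between_commute[of E N L] edges_between_commute[of E N R]
    by (simp add: algebra_simps)
qed

section \<open>Upper bounds on connectivity from cuts and separators\<close>

text \<open>Once the edges of the cut are deleted, no walk from \<open>x\<close> leaves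
  \<open>X\<close>, so \<open>y\<close> cannot be reached.\<close>

lemma edge_connectivity_le_cut_size:
  assumes X: "X \<subseteq> V" "x \<in> X" "y \<in> V - X"
  shows "edge_connectivity V E \<le> cut_size E X"
proof -
  define F where "F = {e \<in> E. \<exists>x y. e = {x, y} \<and> x \<in> X \<and> y \<notin> X}"
  have "z \<in> X" if "(x, z) \<in> (adj_rel (E - F))\<^sup>*" for z
    using that
  proof induction
    case (step y z)
    then show ?case
      by (auto simp: adj_rel_def F_def)
  qed (use X in simp)
  then have "\<not> connected_graph V (E - F)"
    using X by (auto simp: connected_graph_def)
  moreover have "F \<subseteq> E"
    by (auto simp: F_def)
  ultimately have "Min (card ` {F. F \<subseteq> E \<and> \<not> connected_graph V (E - F)}) \<le> card F"
    using finite_edges by (intro Min_le) auto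
  \<comment> \<open>The branch of the definition for at most one vertex has value 0 and is
    trivial.\<close>
  then show ?thesis
    by (simp add: edge_connectivity_def F_def cut_size_def)
qed

text \<open>No walk avoiding \<open>S\<close> leaves \<open>X\<close>, because an edge out of
  \<open>X\<close> would have to end in \<open>S\<close>.\<close>

lemma vertex_connectivity_le_separator:
  assumes S: "S \<subseteq> V" and X: "x \<in> X" "y \<in> V - S - X" "X \<subseteq> V - S"
    and sep: "\<And>u w. u \<in> X \<Longrightarrow> w \<in> V - S - X \<Longrightarrow> {u, w} \<notin> E"
  shows "vertex_connectivity V E \<le> card S"
proof -
  have "z \<in> X" if "(x, z) \<in> (adj_rel {e \<in> E. e \<inter> S = {}})\<^sup>*" for z
    using that
  proof induction
    case (step y z)
    then show ?case
      using sep[of y z] edge_ends[of y z] by (auto simp: adj_rel_def)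
  qed (use X in simp)
  then have "\<not> connected_graph (V - S) {e \<in> E. e \<inter> S = {}}"
    using X by (auto simp: connected_graph_def)
  then show ?thesis
    unfolding vertex_connectivity_def using S finite_vertices by (intro Min_le) auto
qed

text \<open>Applied to the middle parts \<open>{a, b}\<close> and \<open>{b, c}\<close>,
  \<open>two_small_cuts\<close> leaves \<open>L\<close> attached to \<open>a\<close> and
  \<open>b\<close> only, and \<open>R\<close> to \<open>b\<close> and \<open>c\<close> only.
  Comparing cuts with degrees then allows at most one edge from \<open>b\<close> to each of
  \<open>L\<close> and \<open>R\<close>, so \<open>b\<close> has degree at most 4.\<close>

lemma three_singletons_low_connectivity:
  assumes V_eq: "V = L \<union> {a, b, c} \<union> R"
    and disj: "L \<inter> R = {}" "{a, b, c} \<inter> L = {}" "{a, b, c} \<inter> R = {}"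
    and abc: "a \<noteq> b" "a \<noteq> c" "b \<noteq> c" and "L \<noteq> {}"
    and La: "cut_size E L < degree E a" and Lb: "cut_size E (insert a L) < degree E b"
    and Rb: "cut_size E (insert c R) < degree E b" and Rc: "cut_size E R < degree E c"
  shows "min_degree V E \<le> 4" "edge_connectivity V E \<le> 3" "vertex_connectivity V E \<le> 2"
proof -
  let ?e = "edges_between E"
  have LR: "L \<subseteq> V" "R \<subseteq> V" "insert a L \<subseteq> V" "insert c R \<subseteq> V" "b \<in> V"
    using V_eq by auto
  have fin: "finite L" "finite R"
    using LR finite_vertices by (auto intro: finite_subset)
  have "V - L - insert c R = {a, b}" "V - insert a L - R = {b, c}"
    using V_eq disj abc by auto
  \<comment> \<open>With \<open>s = 0\<close> the degree term vanishes, and no edge can join the two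
    outer sets.\<close>
  then have 1: "?e L (insert c R) = 0" and 2: "?e (insert a L) R = 0"
    using two_small_cuts[of L "insert c R" a b 0] two_small_cuts[of "insert a L" R b c 0]
      La Lb Rb Rc abc LR disj by auto
  have zero: "?e L {c} = 0" "?e L R = 0" "?e {a} R = 0"
    using 1 2 edges_between_Un_right[of "{c}" R E L] edges_between_Un_left[of "{a}" L E R] fin disj
    by auto
  \<comment> \<open>Right-nested unions match \<open>edges_between_Un_right\<close>, with one
    disjointness fact of \<open>inter\<close> per union.\<close>
  have V': "V = L \<union> ({a} \<union> ({b} \<union> ({c} \<union> R)))"
    using V_eq by auto
  have inter: "L \<inter> ({a} \<union> ({b} \<union> ({c} \<union> R))) = {}" "{a} \<inter> ({b} \<union> ({c} \<union> R)) = {}"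
    "{b} \<inter> ({c} \<union> R) = {}" "{c} \<inter> R = {}"
    using disj abc by auto
  have eV: "?e X V = ?e X L + (?e X {a} + (?e X {b} + (?e X {c} + ?e X R)))" for X
    by (subst V') (use fin inter in
      \<open>simp only: edges_between_Un_right finite.intros finite_UnI\<close>)
  have VL: "V - L = {a} \<union> ({b} \<union> ({c} \<union> R))"
    using V_eq disj by auto
  have cL: "cut_size E L = ?e L {a} + (?e L {b} + (?e L {c} + ?e L R))"
    by (simp only: cut_size_eq_edges_between[OF LR(1)] VL edges_between_Un_right
        finite.intros finite_UnI fin inter)
  have VR: "V - R = {c} \<union> ({b} \<union> ({a} \<union> L))"
    using V_eq disj by auto
  have inter': "{c} \<inter> ({b} \<union> ({a} \<union> L)) = {}" "{b} \<inter> ({a} \<union> L) = {}" "{a} \<inter> L = {}"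
    using disj abc by auto
  have cR: "cut_size E R = ?e R {c} + (?e R {b} + (?e R {a} + ?e R L))"
    by (simp only: cut_size_eq_edges_between[OF LR(2)] VR edges_between_Un_right
        finite.intros finite_UnI fin inter')
  have no_loop: "?e {x} {x} = 0" for x
    using edge_ends(3)[of x x] by (auto simp: edges_between_def)
  note comm = edges_between_commute[of E "{a}" L] edges_between_commute[of E "{c}" L]
    edges_between_commute[of E "{b}" L] edges_between_commute[of E "{b}" R]
    edges_between_commute[of E "{c}" R] edges_between_commute[of E "{a}" R]
    edges_between_commute[of E R L]
  note le1 = edges_between_singletons_le[of E]
  \<comment> \<open>The edges between \<open>a\<close> and \<open>L\<close> occur on both sides of
    the cut inequality and cancel.\<close>
  have "?e L {b} < ?e {a} {b} + ?e {a} {c}"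
    using La cL eV[of "{a}"] no_loop[of a] zero comm by (simp add: degree_eq_edges_between)
  then have bL: "?e L {b} \<le> 1"
    using le1[of a b] le1[of a c] by linarith
  have "?e R {b} < ?e {c} {b} + ?e {c} {a}"
    using Rc cR eV[of "{c}"] no_loop[of c] zero comm by (simp add: degree_eq_edges_between)
  then have bR: "?e R {b} \<le> 1"
    using le1[of c b] le1[of c a] by linarith
  have deg_b: "degree E b \<le> 4"
    using eV[of "{b}"] no_loop[of b] bL bR comm le1[of b a] le1[of b c]
    by (simp add: degree_eq_edges_between)
  with min_degree_le[OF LR(5)] show "min_degree V E \<le> 4"
    by simp
  have "edge_connectivity V E \<le> cut_size E (insert a L)"
    using LR abc disj by (intro edge_connectivity_le_cut_size[of _ a b]) auto
  with Lb deg_b show "edge_connectivity V E \<le> 3"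
    by simp
  obtain x where x: "x \<in> L"
    using \<open>L \<noteq> {}\<close> by auto
  have VS: "V - {a, b} - L = insert c R"
    using V_eq disj abc by auto
  \<comment> \<open>By fact \<open>1\<close>, every edge leaving \<open>L\<close> ends in
    \<open>a\<close> or \<open>b\<close>.\<close>
  have "vertex_connectivity V E \<le> card {a, b}"
  proof (rule vertex_connectivity_le_separator[of _ x L c])
    show "{u, w} \<notin> E" if "u \<in> L" "w \<in> V - {a, b} - L" for u w
      using no_edge_if_edges_between_0[OF 1] that fin unfolding VS by simp
  qed (use x VS V_eq disj in auto)
  then show "vertex_connectivity V E \<le> 2"
    using abc by simp
qed

section \<open>Local edge-connectivity and pendant pairs\<close>

lemma local_edge_connectivity_le:
  assumes "X \<subseteq> V" "v \<in> X \<longleftrightarrow> w \<notin> X"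
  shows "local_edge_connectivity V E v w \<le> cut_size E X"
  unfolding local_edge_connectivity_def
  using assms finite_vertices by (intro Min_le imageI CollectI conjI) simp_all

lemma local_edge_connectivity_obtain:
  assumes "v \<in> V" "v \<noteq> w"
  obtains X where "X \<subseteq> V" "v \<in> X \<longleftrightarrow> w \<notin> X" "cut_size E X = local_edge_connectivity V E v w"
proof -
  define S where "S = {X. X \<subseteq> V \<and> (v \<in> X \<longleftrightarrow> w \<notin> X)}"
  \<comment> \<open>The minimum is attained because the family of cuts is nonempty.\<close>
  have "{v} \<in> S"
    using assms by (simp add: S_def)
  moreover have "finite S"
    using finite_vertices by (simp add: S_def)
  ultimately have "Min (cut_size E ` S) \<in> cut_size E ` S"
    by (intro Min_in) auto
  then obtain X where "X \<in> S" "Min (cut_size E ` S) = cut_size E X"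
    by blast
  with that[of X] show ?thesis
    by (simp add: S_def local_edge_connectivity_def)
qed

lemma local_edge_connectivity_le_degree:
  assumes "v \<in> V" "w \<in> V" "v \<noteq> w"
  shows "local_edge_connectivity V E v w \<le> degree E v"
    and "local_edge_connectivity V E v w \<le> degree E w"
  using local_edge_connectivity_le[of "{v}" v w] local_edge_connectivity_le[of "{w}" v w] assms
  by (simp_all add: cut_size_singleton)

text \<open>A cut for \<open>a, b\<close> smaller than that for \<open>a', b'\<close> would separate \<open>a\<close> from \<open>a'\<close> or \<open>b\<close> from \<open>b'\<close>,
  but these pairs are pendant.\<close>

lemma non_pendant_degree_gt:
  assumes A: "\<And>v w. v \<in> A \<Longrightarrow> w \<in> A \<Longrightarrow> v \<noteq> w \<Longrightarrow> pendant_pair V E v w"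
    and B: "\<And>v w. v \<in> B \<Longrightarrow> w \<in> B \<Longrightarrow> v \<noteq> w \<Longrightarrow> pendant_pair V E v w"
    and sub: "A \<subseteq> V" "B \<subseteq> V" and disj: "A \<inter> B = {}"
    and ab: "a \<in> A" "b \<in> B" "\<not> pendant_pair V E a b" and a'b': "a' \<in> A" "b' \<in> B"
  shows "local_edge_connectivity V E a' b' < degree E a"
    and "local_edge_connectivity V E a' b' < degree E b"
proof -
  let ?l = "local_edge_connectivity V E"
  have V: "a \<in> V" "b \<in> V" "a \<noteq> b" "a' \<in> V" "b' \<in> V" "a' \<noteq> b'"
    using sub ab a'b' disj by auto
  have less: "?l a b < degree E a" "?l a b < degree E b"
    using local_edge_connectivity_le_degree[OF V(1-3)] ab V by (auto simp: pendant_pair_def)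
  obtain X where X: "X \<subseteq> V" "a \<in> X \<longleftrightarrow> b \<notin> X" "cut_size E X = ?l a b"
    using local_edge_connectivity_obtain V by metis
  note deg' = local_edge_connectivity_le_degree[OF V(4-6)]
  have "?l a' b' \<le> ?l a b"
  proof (cases "a \<in> X \<longleftrightarrow> a' \<in> X")
    case False
    \<comment> \<open>\<open>X\<close> now bounds the smaller of the two degrees by
      \<open>?l a b\<close>. As \<open>?l a b < degree E a\<close>, the smaller one is
      \<open>degree E a'\<close>, which is at least \<open>?l a' b'\<close>.\<close>
    then have "?l a a' = min (degree E a) (degree E a')"
      using A[of a a'] ab a'b' by (auto simp: pendant_pair_def)
    then show ?thesis
      using local_edge_connectivity_le[of X a a'] X False less deg' by auto
  next
    case a_side: True
    show ?thesis
    proof (cases "b \<in> X \<longleftrightarrow> b' \<in> X")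
      case False
      then have "?l b b' = min (degree E b) (degree E b')"
        using B[of b b'] ab a'b' by (auto simp: pendant_pair_def)
      then show ?thesis
        using local_edge_connectivity_le[of X b b'] X False less deg' by auto
    next
      case True
      then show ?thesis
        using local_edge_connectivity_le[of X a' b'] X a_side by auto
    qed
  qed
  with less show "?l a' b' < degree E a" "?l a' b' < degree E b"
    by auto
qed

end

section \<open>Trees\<close>

lemma card_2_other:
  assumes "card S = 2" "x \<in> S"
  obtains y where "S = {x, y}" "x \<noteq> y"
  using assms unfolding card_2_iff by (metis insertE insert_commute singletonD)

text \<open>When the next vertex already lies on the path, the path is truncated there instead of
  extended. The list form is what \<open>is_cycle\<close> needs.\<close>

lemma rtrancl_distinct_path:
  assumes "(x, y) \<in> r\<^sup>*"
  obtains xs where "xs \<noteq> []" "hd xs = x" "last xs = y" "distinct xs"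
    "\<And>i. Suc i < length xs \<Longrightarrow> (xs ! i, xs ! Suc i) \<in> r"
proof -
  have "\<exists>xs. xs \<noteq> [] \<and> hd xs = x \<and> last xs = y \<and> distinct xs \<and>
      (\<forall>i. Suc i < length xs \<longrightarrow> (xs ! i, xs ! Suc i) \<in> r)"
    using assms
  proof induction
    case base
    show ?case
      by (rule exI[of _ "[x]"]) simp
  next
    case (step y z)
    then obtain xs where xs: "xs \<noteq> []" "hd xs = x" "last xs = y" "distinct xs"
      "\<forall>i. Suc i < length xs \<longrightarrow> (xs ! i, xs ! Suc i) \<in> r"
      by blast
    show ?case
    proof (cases "z \<in> set xs")
      case True
      then obtain j where j: "j < length xs" "xs ! j = z"
        by (auto simp: in_set_conv_nth)
      show ?thesis
        using xs j by (intro exI[of _ "take (Suc j) xs"]) (auto simp: last_conv_nth min_def le_Suc_eq)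
    next
      case False
      have "((xs @ [z]) ! i, (xs @ [z]) ! Suc i) \<in> r" if "Suc i < length (xs @ [z])" for i
      proof (cases "Suc i < length xs")
        case True
        then show ?thesis
          using xs by (simp add: nth_append)
      next
        case False
        then have "length xs = Suc i"
          using that by simp
        moreover from this have "xs ! i = y"
          using xs by (simp add: last_conv_nth)
        ultimately show ?thesis
          using step.hyps by (simp add: nth_append)
      qed
      then show ?thesis
        using xs False by (intro exI[of _ "xs @ [z]"]) auto
    qed
  qed
  with that show ?thesis
    by blast
qed

section \<open>The two sides of a tree edge\<close>

definition neighbours :: "'a set set \<Rightarrow> 'a \<Rightarrow> 'a set" where
  "neighbours E v = {w. {v, w} \<in> E}"

text \<open>This is \<open>tree_side\<close> before the union of blocks is taken, so that the tree
  arguments work for vertices of any type.\<close>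

definition edge_side :: "'a set set \<Rightarrow> 'a \<Rightarrow> 'a \<Rightarrow> 'a set" where
  "edge_side E v w = {u. (v, u) \<in> (adj_rel (E - {{v, w}}))\<^sup>*}"

lemma tree_side_eq: "tree_side E A B = \<Union> (edge_side E A B)"
  by (simp add: tree_side_def edge_side_def)

lemma edge_side_self: "v \<in> edge_side E v w"
  by (simp add: edge_side_def)

lemma edge_side_step:
  assumes "u \<in> edge_side E v w" "{u, u'} \<in> E" "{u, u'} \<noteq> {v, w}"
  shows "u' \<in> edge_side E v w"
  using assms by (auto simp: edge_side_def adj_rel_def intro: rtrancl_into_rtrancl)

lemma edge_side_induct [consumes 1, case_names self step]:
  assumes "u \<in> edge_side E v w" "Q v"
    and "\<And>u u'. u \<in> edge_side E v w \<Longrightarrow> Q u \<Longrightarrow> {u, u'} \<in> E \<Longrightarrow> {u, u'} \<noteq> {v, w} \<Longrightarrow> Q u'"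
  shows "Q u"
proof -
  have "(v, u) \<in> (adj_rel (E - {{v, w}}))\<^sup>*"
    using assms(1) by (simp add: edge_side_def)
  then show ?thesis
    by induction (use assms(2,3) in \<open>auto simp: edge_side_def adj_rel_def\<close>)
qed

lemma neighbours_sym: "w \<in> neighbours E v \<longleftrightarrow> v \<in> neighbours E w"
  by (simp add: neighbours_def insert_commute)

lemma edge_if_neighbour:
  assumes "w \<in> neighbours E v"
  shows "{v, w} \<in> E" "{w, v} \<in> E"
  using assms by (simp_all add: neighbours_def insert_commute)

context
  fixes V :: "'a set" and E :: "'a set set"
  assumes tree: "tree_graph V E"
begin

lemma tree_simple: "simple_graph V E"
  using tree by (simp add: tree_graph_def)

lemma neighbours_subset: "neighbours E v \<subseteq> V"
  using edge_ends[OF tree_simple] by (auto simp: neighbours_def)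

lemma finite_neighbours: "finite (neighbours E v)"
  using neighbours_subset finite_vertices[OF tree_simple] by (rule finite_subset)

text \<open>A path from \<open>v\<close> to \<open>w\<close> that avoids the edge would close up
  with it to a cycle.\<close>

lemma edge_is_bridge:
  assumes vw: "{v, w} \<in> E"
  shows "w \<notin> edge_side E v w"
proof
  assume "w \<in> edge_side E v w"
  then obtain xs where xs: "xs \<noteq> []" "hd xs = v" "last xs = w" "distinct xs"
    and path: "\<And>i. Suc i < length xs \<Longrightarrow> (xs ! i, xs ! Suc i) \<in> adj_rel (E - {{v, w}})"
    unfolding edge_side_def by (auto elim: rtrancl_distinct_path)
  have ends: "xs ! 0 = v" "xs ! (length xs - 1) = w"
    using xs by (auto simp: hd_conv_nth last_conv_nth)
  \<comment> \<open>One vertex would make the edge a loop, and a path of two vertices would use the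
    deleted edge.\<close>
  have "length xs \<noteq> 1"
    using ends edge_ends(3)[OF tree_simple vw] by auto
  moreover have "length xs \<noteq> 2"
    using path[of 0] ends by (auto simp: adj_rel_def)
  moreover have "length xs \<noteq> 0"
    using xs by simp
  ultimately have len: "3 \<le> length xs"
    by linarith
  have "{xs ! i, xs ! (Suc i mod length xs)} \<in> E" if "i < length xs" for i
  proof (cases "Suc i = length xs")
    case True
    then have "xs ! i = w"
      using ends by (metis diff_Suc_1)
    with True ends vw show ?thesis
      by (simp add: insert_commute)
  next
    case False
    with that path[of i] show ?thesis
      by (simp add: adj_rel_def)
  qed
  with len xs have "is_cycle E xs"
    by (simp add: is_cycle_def)
  with tree show False
    by (auto simp: tree_graph_def)
qed

lemma edge_side_subset:
  assumes "v \<in> V"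
  shows "edge_side E v w \<subseteq> V"
proof
  fix u assume "u \<in> edge_side E v w"
  then show "u \<in> V"
    by (induction rule: edge_side_induct) (use assms edge_ends[OF tree_simple] in auto)
qed

text \<open>Both sides are reached along the same symmetric relation, so a common vertex would join
  \<open>v\<close> to \<open>w\<close> without the edge.\<close>

lemma edge_sides_disjoint:
  assumes "{v, w} \<in> E"
  shows "edge_side E v w \<inter> edge_side E w v = {}"
proof (rule ccontr)
  let ?r = "adj_rel (E - {{v, w}})"
  assume "edge_side E v w \<inter> edge_side E w v \<noteq> {}"
  then obtain u where "(v, u) \<in> ?r\<^sup>*" "(w, u) \<in> ?r\<^sup>*"
    by (auto simp: edge_side_def insert_commute)
  moreover have "sym (?r\<^sup>*)"
    by (intro sym_rtrancl) (auto simp: sym_def adj_rel_def insert_commute)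
  ultimately have "(v, w) \<in> ?r\<^sup>*"
    by (meson rtrancl_trans symD)
  with edge_is_bridge[OF assms] show False
    by (simp add: edge_side_def)
qed

text \<open>Along a walk from \<open>v\<close>, each use of the edge itself lands on
  \<open>v\<close> or \<open>w\<close>, and any other step stays on its side.\<close>

lemma edge_sides_cover:
  assumes vw: "{v, w} \<in> E"
  shows "edge_side E v w \<union> edge_side E w v = V"
proof
  show "edge_side E v w \<union> edge_side E w v \<subseteq> V"
    using edge_side_subset edge_ends[OF tree_simple vw] by blast
  show "V \<subseteq> edge_side E v w \<union> edge_side E w v"
  proof
    fix u assume "u \<in> V"
    then have "(v, u) \<in> (adj_rel E)\<^sup>*"
      using tree edge_ends[OF tree_simple vw] by (auto simp: tree_graph_def connected_graph_def)
    then show "u \<in> edge_side E v w \<union> edge_side E w v"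
    proof induction
      case base
      show ?case
        by (simp add: edge_side_self)
    next
      case (step u u')
      have edge: "{u, u'} \<in> E"
        using step.hyps by (simp add: adj_rel_def)
      show ?case
      proof (cases "{u, u'} = {v, w}")
        case True
        then have "u' \<in> {v, w}"
          by blast
        then show ?thesis
          by (auto simp: edge_side_self)
      next
        case False
        then show ?thesis
          using step.IH edge edge_side_step[of u E v w u'] edge_side_step[of u E w v u']
          by (auto simp: insert_commute)
      qed
    qed
  qed
qed

text \<open>A walk inside \<open>edge_side E u v\<close> misses \<open>v\<close>, so it never uses
  the edge \<open>{v, w}\<close>.\<close>

lemma edge_side_mono:
  assumes "u \<in> neighbours E v" "u \<noteq> w"
  shows "edge_side E u v \<subseteq> edge_side E v w"
proof
  fix x assume "x \<in> edge_side E u v"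
  have uv: "{u, v} \<in> E"
    using assms by (simp add: neighbours_def insert_commute)
  note not_v = edge_is_bridge[OF uv]
  show "x \<in> edge_side E v w"
    using \<open>x \<in> edge_side E u v\<close>
  proof (induction rule: edge_side_induct)
    case self
    show ?case
      using edge_side_step[OF edge_side_self, of v u E w] uv assms
      by (auto simp: insert_commute doubleton_eq_iff)
  next
    case (step y y')
    have "y' \<in> edge_side E u v"
      using edge_side_step step by metis
    then have "{y, y'} \<noteq> {v, w}"
      using not_v step.hyps(1) by (auto simp: doubleton_eq_iff)
    then show ?case
      using edge_side_step step by metis
  qed
qed

lemma edge_side_decomp: "edge_side E v w = insert v (\<Union>u\<in>neighbours E v - {w}. edge_side E u v)"
proof
  show "insert v (\<Union>u\<in>neighbours E v - {w}. edge_side E u v) \<subseteq> edge_side E v w"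
    using edge_side_mono[of _ v w] edge_side_self[of v E w] by blast
  show "edge_side E v w \<subseteq> insert v (\<Union>u\<in>neighbours E v - {w}. edge_side E u v)"
  proof
    fix x assume "x \<in> edge_side E v w"
    then show "x \<in> insert v (\<Union>u\<in>neighbours E v - {w}. edge_side E u v)"
    proof (induction rule: edge_side_induct)
      case (step y y')
      show ?case
      proof (cases "y = v")
        case True
        then have "y' \<in> neighbours E v - {w}"
          using step by (auto simp: neighbours_def)
        then show ?thesis
          using edge_side_self by fast
      next
        case False
        then obtain u where u: "u \<in> neighbours E v - {w}" "y \<in> edge_side E u v"
          using step.IH by blast
        \<comment> \<open>The only edge leaving \<open>edge_side E u v\<close> is
          \<open>{u, v}\<close>, which leads back to \<open>v\<close>.\<close>
        then show ?thesis
          using edge_side_step[OF u(2) step.hyps(2)] False by (cases "{y, y'} = {u, v}")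
            (auto simp: doubleton_eq_iff)
      qed
    qed simp
  qed
qed

section \<open>Degree counts and weights in trees\<close>

lemma neighbours_nonempty:
  assumes "v \<in> V" "2 \<le> card V"
  shows "neighbours E v \<noteq> {}"
proof -
  have "V \<noteq> {v}"
    using assms by auto
  then obtain w where w: "w \<in> V" "w \<noteq> v"
    using assms by auto
  then have "(v, w) \<in> (adj_rel E)\<^sup>*"
    using assms tree by (auto simp: tree_graph_def connected_graph_def)
  then show ?thesis
    using w by (cases rule: converse_rtranclE) (auto simp: neighbours_def adj_rel_def)
qed

text \<open>Orient every edge towards a root \<open>r\<close>: every vertex other than \<open>r\<close> is the tail of at most one
  edge, and \<open>r\<close> of none.\<close>

lemma sum_neighbours_le: "(\<Sum>v\<in>V. card (neighbours E v)) + 2 \<le> 2 * card V"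
proof -
  obtain r where r: "r \<in> V"
    using vertices_nonempty[OF tree_simple] by blast
  note fin = finite_vertices[OF tree_simple]
  \<comment> \<open>A pair in \<open>S\<close> is an edge directed from \<open>v\<close> towards the
    root, which lies beyond \<open>w\<close>.\<close>
  define S where "S = {(v, w). {v, w} \<in> E \<and> r \<in> edge_side E w v}"
  have S_V: "fst ` S \<subseteq> V - {r}"
    using edge_ends[OF tree_simple] edge_is_bridge by (fastforce simp: S_def insert_commute)
  have "inj_on fst S"
  proof (rule inj_onI, clarsimp simp: S_def)
    fix v w w'
    assume *: "{v, w} \<in> E" "r \<in> edge_side E w v" "{v, w'} \<in> E" "r \<in> edge_side E w' v"
    show "w = w'"
    proof (rule ccontr)
      assume "w \<noteq> w'"
      \<comment> \<open>Two exits towards the root would put it on both sides of the edge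
        \<open>{v, w'}\<close>.\<close>
      then have "edge_side E w v \<subseteq> edge_side E v w'"
        using * by (intro edge_side_mono) (auto simp: neighbours_def)
      then show False
        using * edge_sides_disjoint[of v w'] by blast
    qed
  qed
  then have S_card: "card S \<le> card V - 1" and S_fin: "finite S"
    using S_V r fin card_inj_on_le[of fst S "V - {r}"] inj_on_finite[of fst S "V - {r}"]
    by auto
  \<comment> \<open>Every edge is directed one way or the other, since one of its two sides contains
    the root.\<close>
  have "(SIGMA v:V. neighbours E v) \<subseteq> S \<union> S\<inverse>"
  proof clarify
    fix v w assume "w \<in> neighbours E v"
    then have "{v, w} \<in> E" "{w, v} \<in> E"
      by (simp_all add: neighbours_def insert_commute)
    then have "(v, w) \<in> S \<or> (w, v) \<in> S"
      using edge_sides_cover[of v w] r by (auto simp: S_def)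
    moreover assume "(v, w) \<notin> S"
    ultimately show "(w, v) \<in> S"
      by simp
  qed
  then have "card (SIGMA v:V. neighbours E v) \<le> card (S \<union> S\<inverse>)"
    using S_fin by (intro card_mono) auto
  also have "\<dots> \<le> card S + card (S\<inverse>)"
    by (rule card_Un_le)
  also have "\<dots> = 2 * card S"
    by (simp add: card_inverse)
  finally have "(\<Sum>v\<in>V. card (neighbours E v)) \<le> 2 * card S"
    using fin finite_neighbours by simp
  moreover have "card V > 0"
    using r fin card_gt_0_iff by blast
  ultimately show ?thesis
    using S_card by linarith
qed

text \<open>The hypothesis on paths is summed over all \<open>v\<close> of degree 2 with both neighbours of degree 2,
  which counts every \<open>s v\<close> at most three times. There are at most six other vertices per leaf.\<close>

lemma tree_weight_bound:
  fixes s :: "'a \<Rightarrow> nat"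
  assumes V2: "2 \<le> card V"
    and leaf: "\<And>v. v \<in> V \<Longrightarrow> card (neighbours E v) = 1 \<Longrightarrow> k \<le> s v"
    and path: "\<And>u v w. \<lbrakk>v \<in> V; neighbours E v = {u, w}; u \<noteq> w; card (neighbours E u) = 2;
      card (neighbours E w) = 2\<rbrakk> \<Longrightarrow> k \<le> 4 * (s u + s v + s w)"
  shows "k * card V \<le> 12 * (\<Sum>v\<in>V. s v)"
proof -
  let ?N = "neighbours E"
  note fin = finite_vertices[OF tree_simple] and finN = finite_neighbours
  define D1 where "D1 = {v \<in> V. card (?N v) = 1}"
  define D2 where "D2 = {v \<in> V. card (?N v) = 2}"
  define D3 where "D3 = {v \<in> V. card (?N v) \<ge> 3}"
  \<comment> \<open>\<open>I\<close> collects the vertices to which the hypothesis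
    \<open>path\<close> applies.\<close>
  define I where "I = {v \<in> D2. ?N v \<subseteq> D2}"
  have pos: "card (?N v) \<ge> 1" if "v \<in> V" for v
    using neighbours_nonempty[OF that V2] finN[of v] by (simp add: Suc_le_eq card_gt_0_iff)
  have V_eq: "V = D2 \<union> (D1 \<union> D3)"
    using pos by (force simp: D1_def D2_def D3_def)
  have disj: "D2 \<inter> (D1 \<union> D3) = {}" "D1 \<inter> D3 = {}"
    by (auto simp: D1_def D2_def D3_def)
  have finD: "finite D1" "finite D2" "finite D3" "finite I"
    using fin by (auto simp: D1_def D2_def D3_def I_def)
  have split: "(\<Sum>v\<in>V. f v) = (\<Sum>v\<in>D2. f v) + ((\<Sum>v\<in>D1. f v) + (\<Sum>v\<in>D3. f v))"
    for f :: "'a \<Rightarrow> nat"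
    by (subst V_eq) (use finD disj in \<open>simp add: sum.union_disjoint\<close>)
  have cardV: "card V = card D2 + (card D1 + card D3)"
    using split[of "\<lambda>_. 1"] by simp
  have sum2: "(\<Sum>v\<in>D2. card (?N v)) = 2 * card D2" and sum1: "(\<Sum>v\<in>D1. card (?N v)) = card D1"
    by (simp_all add: D2_def D1_def)
  define S3 where "S3 = (\<Sum>v\<in>D3. card (?N v))"
  have sum3: "3 * card D3 \<le> S3"
    using sum_mono[of D3 "\<lambda>_. 3" "\<lambda>v. card (?N v)"] by (simp add: D3_def S3_def)
  have "(\<Sum>v\<in>V. card (?N v)) = 2 * card D2 + (card D1 + S3)"
    by (simp only: split sum1 sum2 S3_def)
  \<comment> \<open>The contribution \<open>2 * card D2\<close> cancels.\<close>
  then have sum_le: "card D1 + S3 + 2 \<le> 2 * (card D1 + card D3)"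
    using sum_neighbours_le cardV by simp
  then have D31: "card D3 \<le> card D1"
    using sum3 by presburger
  \<comment> \<open>A degree-2 vertex outside \<open>I\<close> is next to a leaf or a branching, so
    the degree sum over \<open>D1\<close> and \<open>D3\<close> bounds the number of such
    vertices.\<close>
  have "D2 - I \<subseteq> (\<Union>v\<in>D1 \<union> D3. ?N v)"
  proof
    fix v assume "v \<in> D2 - I"
    then obtain w where "w \<in> ?N v" "w \<notin> D2"
      by (auto simp: I_def)
    then have "w \<in> D1 \<union> D3" "v \<in> ?N w"
      using V_eq neighbours_subset neighbours_sym[of w E v] by auto
    then show "v \<in> (\<Union>v\<in>D1 \<union> D3. ?N v)"
      by blast
  qed
  then have "card (D2 - I) \<le> card (\<Union>v\<in>D1 \<union> D3. ?N v)"
    using finD finN by (intro card_mono) auto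
  also have "\<dots> \<le> (\<Sum>v\<in>D1 \<union> D3. card (?N v))"
    using finD by (intro card_UN_le) auto
  also have "\<dots> = card D1 + S3"
    using finD disj by (simp add: sum.union_disjoint S3_def D1_def)
  finally have "card (D2 - I) \<le> 2 * (card D1 + card D3)"
    using sum_le by linarith
  moreover have "card D2 = card I + card (D2 - I)"
    using finD by (metis I_def card_Diff_subset card_mono le_add_diff_inverse mem_Collect_eq subsetI)
  \<comment> \<open>Outside \<open>I\<close> there are at most
    \<open>3 * (card D1 + card D3)\<close> vertices, and \<open>D31\<close> bounds
    \<open>card D3\<close> by \<open>card D1\<close>.\<close>
  ultimately have cardV_le: "card V \<le> card I + 6 * card D1"
    using cardV D31 by presburger
  have "k \<le> 4 * (s v + (\<Sum>w\<in>?N v. s w))" if "v \<in> I" for v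
  proof -
    have "card (?N v) = 2"
      using that by (simp add: I_def D2_def)
    then obtain u w where uw: "?N v = {u, w}" "u \<noteq> w"
      unfolding card_2_iff by blast
    moreover have "u \<in> D2" "w \<in> D2"
      using that uw by (auto simp: I_def)
    ultimately show ?thesis
      using path[OF _ uw] that by (auto simp: I_def D2_def algebra_simps)
  qed
  then have "(\<Sum>v\<in>I. k) \<le> (\<Sum>v\<in>I. 4 * (s v + (\<Sum>w\<in>?N v. s w)))"
    by (rule sum_mono)
  also have "\<dots> = 4 * ((\<Sum>v\<in>I. s v) + (\<Sum>v\<in>I. \<Sum>w\<in>?N v. s w))"
    by (simp add: sum_distrib_left sum.distrib)
  finally have "k * card I \<le> 4 * ((\<Sum>v\<in>I. s v) + (\<Sum>v\<in>I. \<Sum>w\<in>?N v. s w))"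
    by (simp add: mult.commute)
  moreover have "(\<Sum>v\<in>I. s v) \<le> (\<Sum>v\<in>D2. s v)"
    using finD by (intro sum_mono2) (auto simp: I_def)
  \<comment> \<open>After swapping the sums, each \<open>w\<close> of degree 2 is a neighbour of at
    most two vertices of \<open>I\<close>. With its own term its weight occurs at most three times,
    whence the constant \<open>12 = 4 * 3\<close>.\<close>
  moreover have "(\<Sum>v\<in>I. \<Sum>w\<in>?N v. s w) \<le> 2 * (\<Sum>w\<in>D2. s w)"
  proof -
    have "(\<Sum>v\<in>I. \<Sum>w\<in>?N v. s w) = (\<Sum>v\<in>I. \<Sum>w | w \<in> D2 \<and> w \<in> ?N v. s w)"
      by (intro sum.cong) (auto simp: I_def)
    also have "\<dots> = (\<Sum>w\<in>D2. \<Sum>v | v \<in> I \<and> w \<in> ?N v. s w)"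
      using finD by (intro sum.swap_restrict) auto
    also have "\<dots> \<le> (\<Sum>w\<in>D2. 2 * s w)"
    proof (rule sum_mono)
      fix w assume w: "w \<in> D2"
      have "card {v \<in> I. w \<in> ?N v} \<le> card (?N w)"
        using finN neighbours_sym[of w E] by (intro card_mono) auto
      with w show "(\<Sum>v | v \<in> I \<and> w \<in> ?N v. s w) \<le> 2 * s w"
        by (simp add: D2_def)
    qed
    finally show ?thesis
      by (simp add: sum_distrib_left)
  qed
  ultimately have interior: "k * card I \<le> 12 * (\<Sum>v\<in>D2. s v)"
    by (simp add: distrib_left)
  have leaves: "k * card D1 \<le> (\<Sum>v\<in>D1. s v)"
    using sum_mono[of D1 "\<lambda>_. k" s] leaf by (simp add: D1_def mult.commute)
  have "k * card V \<le> k * card I + 6 * (k * card D1)"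
    using mult_le_mono2[OF cardV_le, of k] by (simp add: algebra_simps)
  \<comment> \<open>The leaves are charged only six times, and \<open>D1\<close> is disjoint from
    \<open>D2\<close>.\<close>
  also have "\<dots> \<le> 12 * ((\<Sum>v\<in>D2. s v) + (\<Sum>v\<in>D1. s v))"
    using interior leaves by (simp add: distrib_left)
  also have "\<dots> \<le> 12 * (\<Sum>v\<in>V. s v)"
    using split[of s] by simp
  finally show ?thesis .
qed

end

section \<open>Pendant trees\<close>

context
  fixes V :: "'a set" and E :: "'a set set"
    and P :: "'a set set" and TE :: "'a set set set"
  assumes graph: "simple_graph V E" and pendant: "pendant_tree V E P TE"
begin

lemma blocks_partition: "partition_on V P"
  and blocks_tree: "tree_graph P TE"
  using pendant by (simp_all add: pendant_tree_def)

lemma block_subset: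
  assumes "A \<in> P"
  shows "A \<subseteq> V"
  using partition_onD1[OF blocks_partition] assms by blast

lemma block_card_pos:
  assumes "A \<in> P"
  shows "1 \<le> card A"
proof -
  have "finite A"
    using block_subset[OF assms] finite_vertices[OF graph] by (rule finite_subset)
  moreover have "A \<noteq> {}"
    using partition_onD3[OF blocks_partition] assms by auto
  ultimately show ?thesis
    by (simp add: Suc_le_eq card_gt_0_iff)
qed

lemma blocks_disjoint:
  assumes "A \<in> P" "B \<in> P" "A \<noteq> B"
  shows "A \<inter> B = {}"
  using disjointD[OF partition_onD2[OF blocks_partition]] assms by simp

lemma tree_edge_blocks:
  assumes "{A, B} \<in> TE"
  shows "A \<in> P" "B \<in> P" "A \<noteq> B"
  using edge_ends[OF tree_simple[OF blocks_tree] assms] by simp_all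

lemma tree_sides:
  assumes AB: "{A, B} \<in> TE"
  shows "tree_side TE A B \<union> tree_side TE B A = V"
    and "tree_side TE A B \<inter> tree_side TE B A = {}"
proof -
  note cover = edge_sides_cover[OF blocks_tree AB]
  have "tree_side TE A B \<union> tree_side TE B A = \<Union> P"
    by (simp add: tree_side_eq cover flip: Union_Un_distrib)
  then show "tree_side TE A B \<union> tree_side TE B A = V"
    using partition_onD1[OF blocks_partition] by simp
  have "X \<inter> Y = {}" if XY: "X \<in> edge_side TE A B" "Y \<in> edge_side TE B A" for X Y
  proof (rule blocks_disjoint)
    show "X \<in> P" "Y \<in> P"
      using XY cover by (metis UnI1, metis UnI2)
    show "X \<noteq> Y"
      using XY edge_sides_disjoint[OF blocks_tree AB] by (metis disjoint_iff)
  qed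
  then show "tree_side TE A B \<inter> tree_side TE B A = {}"
    unfolding tree_side_eq by (metis Int_emptyI UnionE disjoint_iff)
qed

lemma tree_side_subset:
  assumes "{A, B} \<in> TE"
  shows "tree_side TE A B \<subseteq> V"
  using tree_sides(1)[OF assms] by (metis Un_upper1)

lemma block_subset_tree_side: "A \<subseteq> tree_side TE A B"
  by (simp add: tree_side_eq Union_upper edge_side_self)

text \<open>Along a path of such blocks, the sides of consecutive tree edges differ by one block
  only.\<close>

lemma tree_side_degree_2:
  assumes "neighbours TE A = {B, C}" "B \<noteq> C"
  shows "tree_side TE A B = A \<union> tree_side TE C A"
proof -
  have "neighbours TE A - {B} = {C}"
    using assms by auto
  then show ?thesis
    unfolding tree_side_eq by (subst edge_side_decomp[OF blocks_tree]) simp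
qed

lemma tree_side_leaf:
  assumes "neighbours TE A = {B}"
  shows "tree_side TE A B = A"
  unfolding tree_side_eq by (subst edge_side_decomp[OF blocks_tree]) (simp add: assms)

text \<open>\<open>non_pendant_degree_gt\<close> is applied to the non-pendant pair and to the pair
  whose local connectivity is the tree cut. Both pairs come with the edge of the pendant
  tree.\<close>

lemma tree_cut_less_degree:
  assumes AB: "{A, B} \<in> TE"
  obtains a b where "a \<in> A" "b \<in> B" "cut_size E (tree_side TE A B) < degree E a"
    "cut_size E (tree_side TE A B) < degree E b"
proof -
  note blocks = tree_edge_blocks[OF AB]
  note rest = pendant[unfolded pendant_tree_def, THEN conjunct2, THEN conjunct2]
  have pairs: "pendant_pair V E v w" if "D \<in> P" "v \<in> D" "w \<in> D" "v \<noteq> w" for D v w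
    using rest[THEN conjunct1, rule_format, OF that] .
  from rest[THEN conjunct2, THEN conjunct1, rule_format, OF AB]
  obtain a b where ab: "a \<in> A" "b \<in> B" "\<not> pendant_pair V E a b"
    by (elim bexE)
  from rest[THEN conjunct2, THEN conjunct2, rule_format, OF AB]
  obtain a' b' where a'b': "a' \<in> A" "b' \<in> B"
    "cut_size E (tree_side TE A B) = local_edge_connectivity V E a' b'"
    by (elim bexE)
  note gt = non_pendant_degree_gt[OF graph pairs[OF blocks(1)] pairs[OF blocks(2)]
      block_subset[OF blocks(1)] block_subset[OF blocks(2)] blocks_disjoint[OF blocks]
      ab a'b'(1,2)]
  show ?thesis
    using that[OF ab(1,2)] gt a'b'(3) by simp
qed

section \<open>Sizes of blocks of tree-degree 1 and 2\<close>

text \<open>The side of a leaf is the leaf itself, so its small cut forces it to be large.\<close>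

lemma leaf_block_large:
  assumes "A \<in> P" "card (neighbours TE A) = 1"
  shows "min_degree V E + 1 \<le> card A"
proof -
  obtain B where B: "neighbours TE A = {B}"
    using assms by (rule_tac card_1_singletonE)
  then have "{A, B} \<in> TE"
    by (auto simp: neighbours_def)
  then obtain a where "a \<in> A" "cut_size E (tree_side TE A B) < degree E a"
    by (rule tree_cut_less_degree)
  then show ?thesis
    using card_gt_min_degree_if_small_cut[OF graph block_subset] assms
    by (simp add: tree_side_leaf[OF B])
qed

text \<open>The parts of the tree beyond \<open>A\<close> and beyond \<open>B\<close> are the sets
  \<open>L\<close> and \<open>R\<close> of \<open>two_small_cuts\<close>, with
  \<open>A \<union> B\<close> as the middle part.\<close>

lemma adjacent_blocks_card:
  assumes A: "neighbours TE A = {X, B}" "X \<noteq> B" and B: "neighbours TE B = {A, Y}" "A \<noteq> Y"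
  shows "card A + card B = 2 \<or> min_degree V E \<le> card A + card B + 1"
proof -
  have "X \<in> neighbours TE A" "B \<in> neighbours TE A" "Y \<in> neighbours TE B"
    using A B by simp_all
  then have edges: "{X, A} \<in> TE" "{A, B} \<in> TE" "{Y, B} \<in> TE"
    by (simp_all add: edge_if_neighbour)
  define L where "L = tree_side TE X A"
  define R where "R = tree_side TE Y B"
  have sub: "L \<subseteq> V" "R \<subseteq> V"
    using tree_side_subset edges by (simp_all add: L_def R_def)
  have A_side: "tree_side TE A B = A \<union> L"
    using tree_side_degree_2[of A B X] A by (auto simp: L_def insert_commute)
  have B_side: "tree_side TE B A = B \<union> R"
    using tree_side_degree_2[of B A Y] B by (auto simp: R_def)
  have AL: "A \<inter> L = {}"
    using tree_sides(2)[OF edges(1)] block_subset_tree_side[of A X] by (auto simp: L_def)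
  have BR: "B \<inter> R = {}"
    using tree_sides(2)[OF edges(3)] block_subset_tree_side[of B Y] by (auto simp: R_def)
  note sides = tree_sides[OF edges(2), unfolded A_side B_side]
  have LR: "L \<inter> R = {}" and AB: "A \<inter> B = {}"
    using sides(2) by blast+
  have M: "V - L - R = A \<union> B"
    unfolding sides(1)[symmetric] using sides(2) AL BR by blast
  obtain a where a: "a \<in> A" "cut_size E L < degree E a"
    using tree_cut_less_degree[OF edges(1)] unfolding L_def by metis
  obtain b where b: "b \<in> B" "cut_size E R < degree E b"
    using tree_cut_less_degree[OF edges(3)] unfolding R_def by metis
  note blocks = tree_edge_blocks[OF edges(2)]
  define s where "s = card A + card B - 2"
  have s: "card A + card B = s + 2"
    using block_card_pos[OF blocks(1)] block_card_pos[OF blocks(2)] by (simp add: s_def)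
  have "finite A" "finite B"
    using block_subset blocks finite_vertices[OF graph] finite_subset by metis+
  then have card_M: "card (V - L - R) = s + 2"
    using s AB by (simp add: M card_Un_disjoint)
  have abM: "a \<in> V - L - R" "b \<in> V - L - R" "a \<noteq> b"
    using a b AB unfolding M by blast+
  \<comment> \<open>The edges between \<open>L\<close> and \<open>R\<close> are dropped. Dividing by
    \<open>s\<close> is possible unless both blocks are singletons.\<close>
  have "s * min_degree V E \<le> s * (s + 3)"
    using two_small_cuts[OF graph sub LR abM a(2) b(2) card_M] by (rule add_leD1)
  then have "s = 0 \<or> min_degree V E \<le> s + 3"
    by (simp only: mult_le_cancel1) linarith
  with s show ?thesis
    by linarith
qed

text \<open>Three singletons are excluded by \<open>conn\<close>. Otherwise two adjacent blocks, say
  \<open>A\<close> and \<open>B\<close>, have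
  \<open>t = (card A - 1) + (card B - 1) \<ge> 1\<close>, and \<open>adjacent_blocks_card\<close>
  gives \<open>min_degree V E \<le> t + 3 \<le> 4 * t\<close>.\<close>

lemma three_consecutive_blocks_card:
  assumes conn: "min_degree V E \<ge> 5 \<or> edge_connectivity V E \<ge> 4 \<or> vertex_connectivity V E \<ge> 3"
    and A: "neighbours TE A = {X, B}" "X \<noteq> B" and B: "neighbours TE B = {A, C}" "A \<noteq> C"
    and C: "neighbours TE C = {B, Y}" "B \<noteq> Y"
  shows "min_degree V E \<le> 4 * ((card A - 1) + (card B - 1) + (card C - 1))"
proof -
  have nbrs: "X \<in> neighbours TE A" "B \<in> neighbours TE A" "C \<in> neighbours TE B"
    "Y \<in> neighbours TE C"
    using A B C by simp_all
  have edges: "{X, A} \<in> TE" "{A, B} \<in> TE" "{B, C} \<in> TE" "{C, B} \<in> TE" "{Y, C} \<in> TE"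
    using nbrs by (simp_all add: edge_if_neighbour)
  note blocks = tree_edge_blocks[OF edges(2)] tree_edge_blocks[OF edges(3)]
  have not_singletons: "\<not> (card A = 1 \<and> card B = 1 \<and> card C = 1)"
  proof
    assume "card A = 1 \<and> card B = 1 \<and> card C = 1"
    then obtain a b c where abc: "A = {a}" "B = {b}" "C = {c}"
      by (metis card_1_singletonE)
    define L where "L = tree_side TE X A"
    define R where "R = tree_side TE Y C"
    have A_side: "tree_side TE A B = insert a L"
      using tree_side_degree_2[of A B X] A abc by (simp add: L_def insert_commute)
    have B_side: "tree_side TE B C = insert b (insert a L)"
      using tree_side_degree_2[of B C A] B abc A_side by (simp add: insert_commute)
    have C_side: "tree_side TE C B = insert c R"
      using tree_side_degree_2[of C B Y] C abc by (simp add: R_def)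
    have "a \<notin> L"
      using tree_sides(2)[OF edges(1)] block_subset_tree_side[of A X] abc by (auto simp: L_def)
    moreover have "b \<notin> insert a L"
      using tree_sides(2)[OF edges(2)] block_subset_tree_side[of B A] abc A_side by auto
    moreover have "c \<notin> R"
      using tree_sides(2)[OF edges(5)] block_subset_tree_side[of C Y] abc by (auto simp: R_def)
    moreover note sides = tree_sides[OF edges(3), unfolded B_side C_side]
    ultimately have disj: "L \<inter> R = {}" "{a, b, c} \<inter> L = {}" "{a, b, c} \<inter> R = {}"
      and ne: "a \<noteq> b" "a \<noteq> c" "b \<noteq> c"
      by blast+
    have V_eq: "V = L \<union> {a, b, c} \<union> R"
      unfolding sides(1)[symmetric] by blast
    have "X \<noteq> {}"
      using block_card_pos[OF tree_edge_blocks(1)[OF edges(1)]] by auto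
    then have L: "L \<noteq> {}"
      using block_subset_tree_side[of X A] by (auto simp: L_def)
    \<comment> \<open>Since the blocks are singletons, the vertices supplied by the tree cuts can
      only be \<open>a\<close>, \<open>b\<close> and \<open>c\<close>.\<close>
    have "cut_size E L < degree E a" "cut_size E (insert a L) < degree E b"
      using tree_cut_less_degree[OF edges(1)] tree_cut_less_degree[OF edges(2)]
      unfolding L_def[symmetric] A_side[symmetric] by (metis abc singletonD)+
    moreover have "cut_size E (insert c R) < degree E b" "cut_size E R < degree E c"
      using tree_cut_less_degree[OF edges(4)] tree_cut_less_degree[OF edges(5)]
      unfolding R_def[symmetric] C_side[symmetric] by (metis abc singletonD)+
    ultimately have cuts: "cut_size E L < degree E a" "cut_size E (insert a L) < degree E b"
      "cut_size E (insert c R) < degree E b" "cut_size E R < degree E c"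
      by simp_all
    show False
      using three_singletons_low_connectivity[OF graph V_eq disj ne L cuts] conn by linarith
  qed
  have pos: "1 \<le> card A" "1 \<le> card B" "1 \<le> card C"
    using block_card_pos blocks by simp_all
  then obtain k l m where "card A = Suc k" "card B = Suc l" "card C = Suc m"
    by (metis One_nat_def Suc_le_D)
  then show ?thesis
    using not_singletons adjacent_blocks_card[OF A B] adjacent_blocks_card[OF B C] by auto
qed

end

section \<open>The bound on the number of blocks\<close>

theorem theorem7:
  fixes V :: "'a set" and E :: "'a set set"
    and P :: "'a set set" and TE :: "'a set set set"
  assumes "simple_graph V E"
    and "min_degree V E \<ge> 5 \<or> edge_connectivity V E \<ge> 4 \<or> vertex_connectivity V E \<ge> 3"
    and "pendant_tree V E P TE"
  shows "real (card P) \<le> 12 / (real (min_degree V E) + 12) * real (card V)"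
proof -
  note tree = blocks_tree[OF assms(1,3)] and part = blocks_partition[OF assms(1,3)]
  let ?d = "min_degree V E"
  have "?d * card P + 12 * card P \<le> 12 * card V"
  proof (cases "2 \<le> card P")
    case True
    \<comment> \<open>The weight of a block is its excess over a singleton, so the total weight is
      \<open>card V - card P\<close>.\<close>
    have "?d * card P \<le> 12 * (\<Sum>A\<in>P. card A - 1)"
    proof (rule tree_weight_bound[OF tree True])
      show "?d \<le> card A - 1" if "A \<in> P" "card (neighbours TE A) = 1" for A
        using leaf_block_large[OF assms(1,3) that] by simp
      fix A B C
      assume B: "neighbours TE B = {A, C}" "A \<noteq> C"
        and "card (neighbours TE A) = 2" "card (neighbours TE C) = 2"
      moreover have "B \<in> neighbours TE A" "B \<in> neighbours TE C"
        using B neighbours_sym[of B TE] by auto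
      ultimately obtain X Y where "neighbours TE A = {B, X}" "B \<noteq> X"
        "neighbours TE C = {B, Y}" "B \<noteq> Y"
        by (metis card_2_other)
      then have "neighbours TE A = {X, B}" "X \<noteq> B" "neighbours TE C = {B, Y}" "B \<noteq> Y"
        by (simp_all add: insert_commute)
      then show "?d \<le> 4 * (card A - 1 + (card B - 1) + (card C - 1))"
        using three_consecutive_blocks_card[OF assms(1,3,2)] B by simp
    qed
    moreover have "(\<Sum>A\<in>P. card A - 1) + card P = card V"
    proof -
      have "(\<Sum>A\<in>P. card A - 1) + card P = (\<Sum>A\<in>P. card A - 1 + 1)"
        by (simp only: sum.distrib card_eq_sum)
      also have "\<dots> = (\<Sum>A\<in>P. card A)"
        using block_card_pos[OF assms(1,3)] by (intro sum.cong refl le_add_diff_inverse2)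
      also have "\<dots> = card V"
        using product_partition[OF part] finite_vertices[OF assms(1)] block_subset[OF assms(1,3)]
        by (metis finite_subset)
      finally show ?thesis .
    qed
    ultimately show ?thesis
      by linarith
  next
    case False
    then have "card P \<le> 1"
      by simp
    then have "?d * card P + 12 * card P \<le> ?d + 12"
      by (cases "card P") auto
    then show ?thesis
      using min_degree_less_card[OF assms(1)] by linarith
  qed
  then have "real (card P) * (real ?d + 12) \<le> 12 * real (card V)"
    by (simp add: algebra_simps flip: of_nat_mult of_nat_add)
  then show ?thesis
    by (simp add: field_simps)
qed

end
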